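(* Suppose $r=\min(m,n)$ where $m\neq n$. If $|\mathbb F|=q<\infty$, then $$\operatorname{rank}(\mathcal M_{mn}^J)=\begin{bmatrix}L\\ l\end{bmatrix}_q,$$ where $L=\max(m,n)$ and $l=\min(m,n)$.
   Context: Let $\mathbb F$ be a field, $m,n\geq1$ integers, and $0\leq r\leq\min(m,n)$. $\mathcal M_{kl}$ denotes the set of all $k\times l$ matrices over $\mathbb F$. Let $J=\begin{bmatrix}I_r&O\\O&O\end{bmatrix}\in\mathcal M_{nm}$ (an $n\times m$ matrix of rank $r$; empty blocks are omitted), and let $\mathcal M_{mn}^J$ be the semigroup with underlying set $\mathcal M_{mn}$ and operation $X\star Y=XJY$. For a semigroup $S$, $\operatorname{rank}(S)$ is the minimum size of a generating set for $S$ (as a semigroup). $[s]_q!=\prod_{i=1}^s(1+q+\cdots+q^{i-1})$, and $\begin{bmatrix}k\\ s\end{bmatrix}_q=\frac{[k]_q!}{[s]_q!\,[k-s]_q!}$ is the $q$-binomial coefficient. *)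

theory Defs
  imports Complex_Main "Jordan_Normal_Form.Matrix"
begin

inductive_set semigroup_closure :: "('a \<Rightarrow> 'a \<Rightarrow> 'a) \<Rightarrow> 'a set \<Rightarrow> 'a set"
  for f :: "'a \<Rightarrow> 'a \<Rightarrow> 'a" and A :: "'a set" where
  base: "a \<in> A \<Longrightarrow> a \<in> semigroup_closure f A"
| mult: "x \<in> semigroup_closure f A \<Longrightarrow> y \<in> semigroup_closure f A \<Longrightarrow> f x y \<in> semigroup_closure f A"

definition semigroup_generates :: "('a \<Rightarrow> 'a \<Rightarrow> 'a) \<Rightarrow> 'a set \<Rightarrow> 'a set \<Rightarrow> bool" where
  "semigroup_generates f S A \<longleftrightarrow> A \<subseteq> S \<and> semigroup_closure f A = S"

text \<open>Meaningful for finitely generated semigroups only: without a finite generating set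
  the \<open>LEAST\<close> below is unspecified.\<close>

definition semigroup_rank :: "('a \<Rightarrow> 'a \<Rightarrow> 'a) \<Rightarrow> 'a set \<Rightarrow> nat" where
  "semigroup_rank f S = (LEAST k. \<exists>A. semigroup_generates f S A \<and> finite A \<and> card A = k)"

lemma semigroup_rank_attained:
  assumes "finite S" and "\<And>x y. x \<in> S \<Longrightarrow> y \<in> S \<Longrightarrow> f x y \<in> S"
  shows "\<exists>A. semigroup_generates f S A \<and> finite A \<and> card A = semigroup_rank f S"
proof -
  have "x \<in> S" if "x \<in> semigroup_closure f S" for x
    using that by (induction rule: semigroup_closure.induct) (assumption, rule assms(2))
  then have "semigroup_generates f S S"
    unfolding semigroup_generates_def using semigroup_closure.base[of _ S f] by blast
  with assms(1) have "\<exists>k A. semigroup_generates f S A \<and> finite A \<and> card A = k"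
    by blast
  then show ?thesis
    unfolding semigroup_rank_def by (rule LeastI_ex)
qed

definition sandwich_J :: "nat \<Rightarrow> nat \<Rightarrow> nat \<Rightarrow> 'a::field mat" where
  "sandwich_J m n r = four_block_mat
     (1\<^sub>m r) (0\<^sub>m r (m - r))
     (0\<^sub>m (n - r) r) (0\<^sub>m (n - r) (m - r))"

definition sandwich_mult :: "'a::field mat \<Rightarrow> 'a mat \<Rightarrow> 'a mat \<Rightarrow> 'a mat" where
  "sandwich_mult J X Y = X * J * Y"

lemma sandwich_J_carrier:
  "r \<le> m \<Longrightarrow> r \<le> n \<Longrightarrow> sandwich_J m n r \<in> carrier_mat n m"
  unfolding sandwich_J_def by (rule carrier_matI) simp_all

lemma sandwich_mult_closed:
  assumes "J \<in> carrier_mat n m" "X \<in> carrier_mat m n" "Y \<in> carrier_mat m n"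
  shows "sandwich_mult J X Y \<in> carrier_mat m n"
  unfolding sandwich_mult_def
  by (rule mult_carrier_mat[OF mult_carrier_mat[OF assms(2) assms(1)] assms(3)])

lemma sandwich_mult_assoc:
  assumes J: "J \<in> carrier_mat n m"
    and X: "X \<in> carrier_mat m n" and Y: "Y \<in> carrier_mat m n" and Z: "Z \<in> carrier_mat m n"
  shows "sandwich_mult J (sandwich_mult J X Y) Z = sandwich_mult J X (sandwich_mult J Y Z)"
proof -
  have XJ: "X * J \<in> carrier_mat m m" and YJ: "Y * J \<in> carrier_mat m m"
    by (rule mult_carrier_mat[OF X J], rule mult_carrier_mat[OF Y J])
  have "X * J * Y * J * Z = (X * J * (Y * J)) * Z"
    by (rule arg_cong[where f = "\<lambda>M. M * Z", OF assoc_mult_mat[OF XJ Y J]])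
  also have "\<dots> = X * J * (Y * J * Z)"
    by (rule assoc_mult_mat[OF XJ YJ Z])
  finally show ?thesis unfolding sandwich_mult_def .
qed

definition q_fact :: "'a::field \<Rightarrow> nat \<Rightarrow> 'a" where
  "q_fact q s = (\<Prod>i=1..s. \<Sum>j<i. q ^ j)"

definition q_binomial :: "'a::field \<Rightarrow> nat \<Rightarrow> nat \<Rightarrow> 'a" where
  "q_binomial q k s = q_fact q k / (q_fact q s * q_fact q (k - s))"

end

theory Submission
  imports Defs "Jordan_Normal_Form.Determinant"
begin

text \<open>Transposition is an anti-isomorphism exchanging \<open>m\<close> and \<open>n\<close>, so let \<open>m > n\<close>. Then the product of
  \<open>X\<close> and \<open>Y\<close> is \<open>X\<close> times the upper \<open>n \<times> n\<close> block of \<open>Y\<close>. If it has full column rank, it has the same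
  column space as \<open>X\<close>, so a generating set meets each orbit of the right action of \<open>GL\<^sub>n\<close> on the
  matrices of full column rank. The action is free, and counting gives the number of orbits.

  Conversely, the semigroup is generated by a suitable transversal of the orbits: the upper blocks of
  its members can be arranged to generate \<open>GL\<^sub>n\<close>, which yields all matrices of full column rank. Since
  \<open>m > n\<close>, their upper blocks include enough singular matrices to generate all \<open>n \<times> n\<close> matrices,
  and every \<open>m \<times> n\<close> matrix is a matrix of full column rank times an \<open>n \<times> n\<close> matrix.\<close>

section \<open>Matrices of full column rank\<close>

text \<open>Full column rank is expressed by a trivial kernel, which suits products, cancellation
  and the count column by column. The set \<open>full_col_rank n n\<close> serves as the general
  linear group.\<close>

definition full_col_rank :: "nat \<Rightarrow> nat \<Rightarrow> 'a::field mat set" where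
  "full_col_rank m n = {X \<in> carrier_mat m n. \<forall>v \<in> carrier_vec n. X *\<^sub>v v = 0\<^sub>v m \<longrightarrow> v = 0\<^sub>v n}"

lemma full_col_rank_carrier: "X \<in> full_col_rank m n \<Longrightarrow> X \<in> carrier_mat m n"
  by (simp add: full_col_rank_def)

lemma full_col_rankD:
  "X \<in> full_col_rank m n \<Longrightarrow> v \<in> carrier_vec n \<Longrightarrow> X *\<^sub>v v = 0\<^sub>v m \<Longrightarrow> v = 0\<^sub>v n"
  by (simp add: full_col_rank_def)

lemma full_col_rank_square_iff:
  assumes "A \<in> carrier_mat n n"
  shows "A \<in> full_col_rank n n \<longleftrightarrow> det A \<noteq> 0"
  using assms det_0_iff_vec_prod_zero_field[OF assms] by (auto simp: full_col_rank_def)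

lemma full_col_rank_obtain_inverse:
  assumes "A \<in> full_col_rank n n"
  obtains B where "B \<in> full_col_rank n n" "A * B = 1\<^sub>m n" "B * A = 1\<^sub>m n"
proof -
  have A: "A \<in> carrier_mat n n" using assms by (rule full_col_rank_carrier)
  have "det A \<noteq> 0" using assms full_col_rank_square_iff[OF A] by simp
  from det_non_zero_imp_unit[OF A this, of "()"]
  obtain B where B: "B \<in> carrier_mat n n" "A * B = 1\<^sub>m n" "B * A = 1\<^sub>m n"
    by (auto simp: Units_def ring_mat_def)
  have "det A * det B = 1" using det_mult[OF A B(1)] B(2) by simp
  then have "det B \<noteq> 0" by auto
  with B full_col_rank_square_iff[OF B(1)] show thesis by (intro that) auto
qed

lemma full_col_rank_mult:
  assumes X: "X \<in> full_col_rank m k" and A: "A \<in> full_col_rank k n"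
  shows "X * A \<in> full_col_rank m n"
proof -
  note XA = full_col_rank_carrier[OF X] full_col_rank_carrier[OF A]
  have "v = 0\<^sub>v n" if "v \<in> carrier_vec n" "X * A *\<^sub>v v = 0\<^sub>v m" for v
  proof -
    have "X *\<^sub>v (A *\<^sub>v v) = 0\<^sub>v m" using that assoc_mult_mat_vec[OF XA that(1)] by simp
    then have "A *\<^sub>v v = 0\<^sub>v k"
      using full_col_rankD[OF X] mult_mat_vec_carrier[OF XA(2) that(1)] by blast
    then show ?thesis using full_col_rankD[OF A] that by blast
  qed
  then show ?thesis using XA by (auto simp: full_col_rank_def)
qed

text \<open>The kernel of \<open>A\<close> lies in that of \<open>X * A\<close>, so the square
  matrix \<open>A\<close> is invertible, and \<open>X\<close> is \<open>X * A\<close> times its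
  inverse.\<close>

lemma full_col_rank_factors:
  assumes XA: "X * A \<in> full_col_rank m n"
    and X: "X \<in> carrier_mat m n" and A: "A \<in> carrier_mat n n"
  shows "A \<in> full_col_rank n n" and "X \<in> full_col_rank m n"
proof -
  have "v = 0\<^sub>v n" if v: "v \<in> carrier_vec n" "A *\<^sub>v v = 0\<^sub>v n" for v
  proof -
    have "X * A *\<^sub>v v = X *\<^sub>v 0\<^sub>v n" using assoc_mult_mat_vec[OF X A v(1)] v by simp
    also have "\<dots> = 0\<^sub>v m" using X by auto
    finally show ?thesis using full_col_rankD[OF XA v(1)] by simp
  qed
  then show A': "A \<in> full_col_rank n n" using A by (auto simp: full_col_rank_def)
  obtain B where B: "B \<in> full_col_rank n n" "A * B = 1\<^sub>m n"
    using full_col_rank_obtain_inverse[OF A'] by blast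
  have "X * A * B = X"
    using assoc_mult_mat[OF X A full_col_rank_carrier[OF B(1)]] B(2) X by simp
  with full_col_rank_mult[OF XA B(1)] show "X \<in> full_col_rank m n" by simp
qed

lemma full_col_rank_inj_on:
  assumes X: "X \<in> full_col_rank m n"
  shows "inj_on ((*\<^sub>v) X) (carrier_vec n)"
proof (rule inj_onI)
  have Xc: "X \<in> carrier_mat m n" using X by (rule full_col_rank_carrier)
  fix u v assume uv: "u \<in> carrier_vec n" "v \<in> carrier_vec n" "X *\<^sub>v u = X *\<^sub>v v"
  have "X *\<^sub>v (u - v) = 0\<^sub>v m"
    using mult_minus_distrib_mat_vec[OF Xc uv(1,2)] uv(3) mult_mat_vec_carrier[OF Xc uv(2)] by simp
  then have "u - v = 0\<^sub>v n"
    using full_col_rankD[OF X] uv by auto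
  then have "(u - v) $ i = 0" if "i < n" for i using that by simp
  then show "u = v" using uv(1,2) by (intro eq_vecI) auto
qed

lemma full_col_rank_cancel:
  assumes X: "X \<in> full_col_rank m n" and A: "A \<in> carrier_mat n k" and B: "B \<in> carrier_mat n k"
    and eq: "X * A = X * B"
  shows "A = B"
proof (rule mat_col_eqI)
  have Xc: "X \<in> carrier_mat m n" using X by (rule full_col_rank_carrier)
  fix j assume "j < dim_col B"
  then have j: "j < k" using B by simp
  have "X *\<^sub>v col A j = X *\<^sub>v col B j"
    using arg_cong[OF eq, of "\<lambda>M. col M j"] col_mult2[OF Xc A j] col_mult2[OF Xc B j] by simp
  then show "col A j = col B j"
    by (rule inj_onD[OF full_col_rank_inj_on[OF X]]) (use A B in auto)
qed (use A B in auto)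

lemma one_full_col_rank: "1\<^sub>m n \<in> full_col_rank n n"
  by (auto simp: full_col_rank_def)

lemma mult_mat_vec_unit_vec:
  fixes A :: "'a::semiring_1 mat"
  assumes "A \<in> carrier_mat m n" "j < n"
  shows "A *\<^sub>v unit_vec n j = col A j"
  using assms by (intro eq_vecI) auto

text \<open>A zero coefficient hides the corresponding column. Thus a column can be exchanged
  without affecting the combinations that do not involve it.\<close>

lemma mult_mat_vec_cong_cols:
  assumes A: "A \<in> carrier_mat m n" and B: "B \<in> carrier_mat m n" and v: "v \<in> carrier_vec n"
    and eq: "\<And>j. j < n \<Longrightarrow> v $ j \<noteq> 0 \<Longrightarrow> col A j = col B j"
  shows "A *\<^sub>v v = B *\<^sub>v (v :: 'a::semiring_1 vec)"
proof (rule eq_vecI)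
  fix i assume "i < dim_vec (B *\<^sub>v v)"
  then have i: "i < m" using B by simp
  have "A $$ (i, j) * v $ j = B $$ (i, j) * v $ j" if j: "j < n" for j
  proof (cases "v $ j = 0")
    case False
    then have "col A j $ i = col B j $ i" using eq j by simp
    then show ?thesis using A B i j by simp
  qed simp
  then show "(A *\<^sub>v v) $ i = (B *\<^sub>v v) $ i"
    using A B v i by (auto simp: scalar_prod_def intro!: sum.cong)
qed (use A B in auto)

section \<open>Eta matrices\<close>

text \<open>The name is that of the elementary matrices of the simplex method.\<close>

definition eta_mat :: "nat \<Rightarrow> nat \<Rightarrow> 'a::semiring_1 vec \<Rightarrow> 'a mat" where
  "eta_mat n k v = mat n n (\<lambda>(i, j). if j = k then v $ i else if i = j then 1 else 0)"

lemma eta_mat_carrier [simp]: "eta_mat n k v \<in> carrier_mat n n"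
  by (simp add: eta_mat_def)

lemma col_eta_mat:
  "j < n \<Longrightarrow> v \<in> carrier_vec n \<Longrightarrow> col (eta_mat n k v) j = (if j = k then v else unit_vec n j)"
  by (rule eq_vecI) (auto simp: eta_mat_def)

lemma col_mult_eta_mat:
  assumes "A \<in> carrier_mat m n" "j < n" "v \<in> carrier_vec n"
  shows "col (A * eta_mat n k v) j = (if j = k then A *\<^sub>v v else col A j)"
  using assms by (simp add: col_mult2[OF assms(1) eta_mat_carrier assms(2)] col_eta_mat
      mult_mat_vec_unit_vec)

lemma index_eta_mat_mult_vec:
  fixes v :: "'a::comm_semiring_1 vec"
  assumes i: "i < n" and k: "k < n" and x: "x \<in> carrier_vec n"
  shows "(eta_mat n k v *\<^sub>v x) $ i = v $ i * x $ k + (if i = k then 0 else x $ i)"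
proof -
  have "(eta_mat n k v *\<^sub>v x) $ i
      = (\<Sum>j = 0..<n. (if j = k then v $ i else if i = j then 1 else 0) * x $ j)"
    using x i by (simp add: eta_mat_def scalar_prod_def)
  also have "\<dots> = (\<Sum>j = 0..<n. (if j = k then v $ i * x $ k else 0)
      + (if j = i then (if i = k then 0 else x $ i) else 0))"
    by (rule sum.cong) auto
  also have "\<dots> = v $ i * x $ k + (if i = k then 0 else x $ i)"
    using i k by (simp add: sum.distrib)
  finally show ?thesis .
qed

text \<open>Row \<open>k\<close> of the homogeneous system forces \<open>x $ k = 0\<close>; the
  other rows then give \<open>x $ i = 0\<close> directly.\<close>

lemma eta_mat_full_col_rank:
  fixes v :: "'a::field vec"
  assumes k: "k < n" and v: "v $ k \<noteq> 0"
  shows "eta_mat n k v \<in> full_col_rank n n"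
proof -
  have "x = 0\<^sub>v n" if x: "x \<in> carrier_vec n" "eta_mat n k v *\<^sub>v x = 0\<^sub>v n" for x
  proof -
    have *: "v $ i * x $ k + (if i = k then 0 else x $ i) = 0" if i: "i < n" for i
      using index_eta_mat_mult_vec[OF i k x(1), of v] x(2) i by simp
    have "x $ k = 0" using *[OF k] v by simp
    then have "x $ i = 0" if "i < n" for i using *[OF that] by (auto split: if_splits)
    then show ?thesis using x by (intro eq_vecI) auto
  qed
  then show ?thesis by (auto simp: full_col_rank_def)
qed

text \<open>This is the exchange step of the elimination: a given vector enters as column
  \<open>k\<close> and the columns before it are kept. Only eta matrices with a nonzero pivot may be
  used, so the case \<open>v $ k = 0\<close> takes a detour through column \<open>j\<close>.\<close>

lemma eta_replace_column:
  fixes N :: "'a::field mat"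
  assumes T: "\<And>A k v. A \<in> T \<Longrightarrow> k < n \<Longrightarrow> v \<in> carrier_vec n \<Longrightarrow> v $ k \<noteq> 0 \<Longrightarrow> A * eta_mat n k v \<in> T"
    and TC: "T \<subseteq> carrier_mat n n"
    and N: "N \<in> T" and v: "v \<in> carrier_vec n" and j: "k \<le> j" "j < n" "v $ j \<noteq> 0"
  obtains N' where "N' \<in> T" "\<And>i. i < k \<Longrightarrow> col N' i = col N i" "col N' k = N *\<^sub>v v"
proof -
  have Nc: "N \<in> carrier_mat n n" and k: "k < n" using N TC j by auto
  show thesis
  proof (cases "v $ k = 0")
    case False
    show thesis
      by (rule that[of "N * eta_mat n k v"])
        (use T[OF N k v False] col_mult_eta_mat[OF Nc _ v] k in auto)
  next
    case True
    then have jk: "j \<noteq> k" using j by auto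
    \<comment> \<open>Replacing column \<open>j\<close> of \<open>N\<close> by the sum of columns
      \<open>j\<close> and \<open>k\<close> changes the coordinates of the vector from
      \<open>v\<close> to \<open>w\<close>, whose pivot \<open>w $ k\<close> is
      \<open>- v $ j\<close>. Since \<open>j > k\<close>, the columns before \<open>k\<close> are
      untouched.\<close>
    define e where "e = unit_vec n j + (unit_vec n k :: 'a vec)"
    define w where "w = v - v $ j \<cdot>\<^sub>v unit_vec n k"
    have e: "e \<in> carrier_vec n" "e $ j \<noteq> 0" and w: "w \<in> carrier_vec n" "w $ k \<noteq> 0"
      using v j k jk True by (auto simp: e_def w_def)
    define N1 where "N1 = N * eta_mat n j e"
    have N1: "N1 \<in> T" unfolding N1_def using T[OF N j(2) e] .
    then have N1c: "N1 \<in> carrier_mat n n" using TC by auto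
    have Ev: "eta_mat n j e *\<^sub>v w = v"
    proof (rule eq_vecI)
      fix i assume "i < dim_vec v"
      then have i: "i < n" using v by simp
      have "(eta_mat n j e *\<^sub>v w) $ i = e $ i * w $ j + (if i = j then 0 else w $ i)"
        using index_eta_mat_mult_vec[OF i j(2) w(1)] .
      also have "\<dots> = v $ i" using i j k jk v True by (auto simp: e_def w_def)
      finally show "(eta_mat n j e *\<^sub>v w) $ i = v $ i" .
    qed (use v in \<open>auto simp: eta_mat_def\<close>)
    have "N1 *\<^sub>v w = N *\<^sub>v v"
      unfolding N1_def using assoc_mult_mat_vec[OF Nc eta_mat_carrier w(1)] Ev by simp
    then show thesis
      by (intro that[of "N1 * eta_mat n k w"])
        (use T[OF N1 k w] col_mult_eta_mat[OF N1c _ w(1)] col_mult_eta_mat[OF Nc _ e(1)] k j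
          in \<open>auto simp: N1_def\<close>)
  qed
qed

text \<open>Elimination runs through the columns of \<open>M\<close> from left to right and absorbs
  each new direction into \<open>N\<close> by an exchange. All pivots are nonzero, so
  \<open>N\<close> stays invertible and any singularity of \<open>M\<close> is left to
  \<open>U\<close>.\<close>

lemma eta_decomposition:
  fixes M :: "'a::field mat"
  assumes one: "1\<^sub>m n \<in> T"
    and T: "\<And>A k v. A \<in> T \<Longrightarrow> k < n \<Longrightarrow> v \<in> carrier_vec n \<Longrightarrow> v $ k \<noteq> 0 \<Longrightarrow> A * eta_mat n k v \<in> T"
    and M: "M \<in> carrier_mat n n"
  obtains N U where "N \<in> T" "N \<in> full_col_rank n n" "U \<in> carrier_mat n n" "upper_triangular U"
    "M = N * U"
proof -
  define T' where "T' = T \<inter> full_col_rank n n"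
  have T': "A * eta_mat n k v \<in> T'"
    if "A \<in> T'" "k < n" "v \<in> carrier_vec n" "v $ k \<noteq> 0" for A k v
    using that T full_col_rank_mult[OF _ eta_mat_full_col_rank] by (auto simp: T'_def)
  have TC: "T' \<subseteq> carrier_mat n n" by (auto simp: T'_def full_col_rank_carrier)
  \<comment> \<open>The vectors \<open>v\<close> are the columns of the triangular factor under
    construction: column \<open>i\<close> of \<open>M\<close> involves only the columns
    \<open>0\<close> to \<open>i\<close> of \<open>N\<close>.\<close>
  have "\<exists>N\<in>T'. \<forall>i<k. \<exists>v\<in>carrier_vec n. col M i = N *\<^sub>v v \<and> (\<forall>j<n. i < j \<longrightarrow> v $ j = 0)"
    if "k \<le> n" for k
    using that
  proof (induction k)
    case 0
    then show ?case using one one_full_col_rank by (auto simp: T'_def)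
  next
    case (Suc k)
    then obtain N where N: "N \<in> T'"
      and cols: "\<And>i. i < k \<Longrightarrow> \<exists>v\<in>carrier_vec n. col M i = N *\<^sub>v v \<and> (\<forall>j<n. i < j \<longrightarrow> v $ j = 0)"
      by auto
    have k: "k < n" using Suc by simp
    have Nc: "N \<in> carrier_mat n n" using N TC by auto
    have cM: "col M k \<in> carrier_vec n" using M k by auto
    obtain B where B: "B \<in> full_col_rank n n" "N * B = 1\<^sub>m n"
      using N full_col_rank_obtain_inverse[of N n] by (auto simp: T'_def)
    have Bc: "B \<in> carrier_mat n n" using B full_col_rank_carrier by auto
    define v where "v = B *\<^sub>v col M k"
    have v: "v \<in> carrier_vec n" unfolding v_def using mult_mat_vec_carrier[OF Bc cM] .
    have Nv: "N *\<^sub>v v = col M k"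
      unfolding v_def using assoc_mult_mat_vec[OF Nc Bc cM] B cM by simp
    \<comment> \<open>If column \<open>k\<close> of \<open>M\<close> has a nonzero coordinate from
      index \<open>k\<close> on, it is exchanged into \<open>N\<close>, where its coordinates become
      a unit vector. Otherwise it already lies in the span of the columns before \<open>k\<close>,
      and \<open>N\<close> is kept.\<close>
    show ?case
    proof (cases "\<exists>j<n. k \<le> j \<and> v $ j \<noteq> 0")
      case True
      then obtain j where j: "k \<le> j" "j < n" "v $ j \<noteq> 0" by auto
      obtain N' where N': "N' \<in> T'" "\<And>i. i < k \<Longrightarrow> col N' i = col N i" "col N' k = N *\<^sub>v v"
        by (rule eta_replace_column[of T' n, OF T' TC N v j]) blast+
      have N'c: "N' \<in> carrier_mat n n" using N' TC by auto
      have "\<exists>v\<in>carrier_vec n. col M i = N' *\<^sub>v v \<and> (\<forall>j<n. i < j \<longrightarrow> v $ j = 0)" if "i < Suc k" for i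
      proof (cases "i = k")
        case True
        have "col M k = N' *\<^sub>v unit_vec n k"
          using N'(3) Nv mult_mat_vec_unit_vec[OF N'c k] by simp
        then show ?thesis using True k by (intro bexI[of _ "unit_vec n k"]) auto
      next
        case False
        then have i: "i < k" using that by simp
        obtain u where u: "u \<in> carrier_vec n" "col M i = N *\<^sub>v u" "\<forall>j<n. i < j \<longrightarrow> u $ j = 0"
          using cols[OF i] by auto
        \<comment> \<open>The coordinates in \<open>u\<close> vanish beyond \<open>i < k\<close>,
          and \<open>N\<close> and \<open>N'\<close> agree on the columns before
          \<open>k\<close>.\<close>
        have "N *\<^sub>v u = N' *\<^sub>v u"
          by (rule mult_mat_vec_cong_cols[OF Nc N'c u(1)]) (metis N'(2) i u(3) linorder_neqE_nat order_less_trans)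
        then show ?thesis using u by auto
      qed
      then show ?thesis using N'(1) by blast
    next
      case False
      have "\<exists>v\<in>carrier_vec n. col M i = N *\<^sub>v v \<and> (\<forall>j<n. i < j \<longrightarrow> v $ j = 0)" if "i < Suc k" for i
        using that cols[of i] v Nv False by (cases "i = k") (auto intro!: bexI[of _ v])
      then show ?thesis using N by blast
    qed
  qed
  from this[OF order_refl] obtain N where N: "N \<in> T'"
    and "\<forall>i<n. \<exists>v\<in>carrier_vec n. col M i = N *\<^sub>v v \<and> (\<forall>j<n. i < j \<longrightarrow> v $ j = 0)" by blast
  then obtain V where V: "\<And>i. i < n \<Longrightarrow> V i \<in> carrier_vec n" "\<And>i. i < n \<Longrightarrow> col M i = N *\<^sub>v V i"
    "\<And>i j. i < n \<Longrightarrow> j < n \<Longrightarrow> i < j \<Longrightarrow> V i $ j = 0" by metis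
  define U where "U = mat n n (\<lambda>(i, j). V j $ i)"
  have Uc: "U \<in> carrier_mat n n" by (simp add: U_def)
  have Nc: "N \<in> carrier_mat n n" using N TC by auto
  have cU: "col U j = V j" if "j < n" for j
    using that V(1)[OF that] by (intro eq_vecI) (auto simp: U_def)
  have "M = N * U"
    by (rule mat_col_eqI)
      (use M Nc Uc V(2) in \<open>auto simp: cU col_mult2[OF Nc Uc]\<close>)
  moreover have "upper_triangular U" using V(3) by (auto simp: U_def)
  ultimately show thesis using N Uc that by (auto simp: T'_def)
qed

text \<open>An upper triangular matrix is the product of the eta matrices formed from its columns,
  the one for the last column standing leftmost.\<close>

lemma mult_upper_triangular_closed:
  fixes U :: "'a::field mat"
  assumes U: "U \<in> carrier_mat n n" "upper_triangular U"
    and N: "N \<in> T" "N \<in> carrier_mat n n"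
    and T: "\<And>A k. A \<in> T \<Longrightarrow> k < n \<Longrightarrow> A * eta_mat n k (col U k) \<in> T"
  shows "N * U \<in> T"
proof -
  \<comment> \<open>\<open>W k\<close> collects the factors for the columns from \<open>k\<close>
    on. It has the columns of the identity before \<open>k\<close> and those of \<open>U\<close>
    from \<open>k\<close> on, so the induction descends from the identity \<open>W n\<close> to
    \<open>U\<close>.\<close>
  define W where "W k = mat n n (\<lambda>(i, j). if k \<le> j then U $$ (i, j) else if i = j then 1 else 0)" for k
  have Wc: "W k \<in> carrier_mat n n" for k by (simp add: W_def)
  have cW: "col (W k) j = (if k \<le> j then col U j else unit_vec n j)" if "j < n" for k j
    using that U by (intro eq_vecI) (auto simp: W_def)
  have "N * W k \<in> T" if "k \<le> n" for k
    using that
  proof (induction rule: inc_induct)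
    case base
    have "W n = 1\<^sub>m n" by (rule mat_col_eqI) (auto simp: cW W_def)
    then show ?case using N by simp
  next
    case (step k)
    then have k: "k < n" by simp
    have cU: "col U k \<in> carrier_vec n" using U k by auto
    \<comment> \<open>Column \<open>k\<close> of \<open>U\<close> has no nonzero entry below the
      diagonal, and the columns of \<open>W (Suc k)\<close> up to index \<open>k\<close> are unit
      vectors.\<close>
    have "W (Suc k) *\<^sub>v col U k = 1\<^sub>m n *\<^sub>v col U k"
    proof (rule mult_mat_vec_cong_cols[OF Wc one_carrier_mat cU])
      fix j assume "j < n" "col U k $ j \<noteq> 0"
      then have "j \<le> k" using U k by (metis carrier_matD index_col not_less upper_triangularD)
      then show "col (W (Suc k)) j = col (1\<^sub>m n) j" using \<open>j < n\<close> by (simp add: cW)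
    qed
    then have e: "W (Suc k) *\<^sub>v col U k = col U k" using cU by simp
    have "W k = W (Suc k) * eta_mat n k (col U k)"
    proof (rule mat_col_eqI)
      fix j assume "j < dim_col (W (Suc k) * eta_mat n k (col U k))"
      then have j: "j < n" by (simp add: eta_mat_def)
      show "col (W k) j = col (W (Suc k) * eta_mat n k (col U k)) j"
        unfolding col_mult_eta_mat[OF Wc j cU] e using j by (auto simp: cW)
    qed (auto simp: W_def eta_mat_def)
    then have "N * W k = N * W (Suc k) * eta_mat n k (col U k)"
      using assoc_mult_mat[OF N(2) Wc eta_mat_carrier] by simp
    then show ?case using T[OF step.IH k] by simp
  qed
  moreover have "W 0 = U" using U by (intro eq_matI) (auto simp: W_def)
  ultimately show ?thesis by (metis le0)
qed

text \<open>The triangular factor of an invertible matrix is invertible, so its diagonal has no zero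
  and its eta factors all have a nonzero pivot.\<close>

lemma full_col_rank_subset_eta_closed:
  assumes one: "1\<^sub>m n \<in> T"
    and T: "\<And>A k v. A \<in> T \<Longrightarrow> k < n \<Longrightarrow> v \<in> carrier_vec n \<Longrightarrow> v $ k \<noteq> 0 \<Longrightarrow> A * eta_mat n k v \<in> T"
  shows "full_col_rank n n \<subseteq> T"
proof
  fix M :: "'a mat" assume M: "M \<in> full_col_rank n n"
  obtain N U where NU: "N \<in> T" "N \<in> full_col_rank n n" "U \<in> carrier_mat n n" "upper_triangular U"
    "M = N * U"
    using eta_decomposition[OF one T full_col_rank_carrier[OF M]] by blast
  have Nc: "N \<in> carrier_mat n n" using NU full_col_rank_carrier by auto
  have "U \<in> full_col_rank n n" using full_col_rank_factors(1)[OF _ Nc NU(3)] M NU by simp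
  then have "det U \<noteq> 0" using full_col_rank_square_iff[OF NU(3)] by simp
  then have "prod_list (diag_mat U) \<noteq> 0" using det_upper_triangular[OF NU(4,3)] by simp
  then have d: "U $$ (k, k) \<noteq> 0" if "k < n" for k
    using that NU(3) by (auto simp: diag_mat_def)
  show "M \<in> T" unfolding NU(5)
    by (rule mult_upper_triangular_closed[OF NU(3,4,1) Nc T]) (use d NU(3) in auto)
qed

text \<open>The closure condition now covers singular eta matrices, so it absorbs a triangular
  factor with zeros on the diagonal.\<close>

lemma carrier_mat_subset_eta_closed:
  assumes one: "1\<^sub>m n \<in> T"
    and T: "\<And>A k v. A \<in> T \<Longrightarrow> k < n \<Longrightarrow> v \<in> carrier_vec n \<Longrightarrow> A * eta_mat n k v \<in> T"
  shows "carrier_mat n n \<subseteq> (T :: 'a::field mat set)"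
proof
  fix M :: "'a mat" assume M: "M \<in> carrier_mat n n"
  obtain N U where NU: "N \<in> T" "N \<in> full_col_rank n n" "U \<in> carrier_mat n n" "upper_triangular U"
    "M = N * U"
    using eta_decomposition[OF one T M] by blast
  show "M \<in> T" unfolding NU(5)
    by (rule mult_upper_triangular_closed[OF NU(3,4,1) full_col_rank_carrier[OF NU(2)] T])
      (use NU(3) in auto)
qed

text \<open>Padding \<open>X\<close> with zero columns gives a square matrix, which factors as an
  invertible matrix times a triangular one. The first \<open>n\<close> columns of the former and the
  upper left block of the latter are \<open>Y\<close> and \<open>A\<close>.\<close>

lemma full_col_rank_factorization:
  fixes X :: "'a::field mat"
  assumes X: "X \<in> carrier_mat m n" and nm: "n \<le> m"
  obtains Y A where "Y \<in> full_col_rank m n" "A \<in> carrier_mat n n" "X = Y * A"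
proof -
  define M where "M = mat m m (\<lambda>(i, j). if j < n then X $$ (i, j) else 0)"
  have Mc: "M \<in> carrier_mat m m" by (simp add: M_def)
  \<comment> \<open>With \<open>T = UNIV\<close> the closure conditions hold trivially, and only the
    factorization remains.\<close>
  obtain N U where NU: "N \<in> full_col_rank m m" "U \<in> carrier_mat m m" "upper_triangular U" "M = N * U"
    using eta_decomposition[OF UNIV_I UNIV_I Mc] by blast
  have Nc: "N \<in> carrier_mat m m" using NU full_col_rank_carrier by auto
  define Y where "Y = mat m n (\<lambda>(i, j). N $$ (i, j))"
  define A where "A = mat n n (\<lambda>(i, j). U $$ (i, j))"
  define E where "E = mat m n (\<lambda>(i, j). if i = j then 1 else 0 :: 'a)"
  have E: "E \<in> full_col_rank m n"
  proof -
    have "v = 0\<^sub>v n" if v: "v \<in> carrier_vec n" "E *\<^sub>v v = 0\<^sub>v m" for v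
    proof (rule eq_vecI)
      fix i assume "i < dim_vec (0\<^sub>v n :: 'a vec)"
      then have i: "i < n" by simp
      have "(E *\<^sub>v v) $ i = (\<Sum>j = 0..<n. (if i = j then 1 else 0) * v $ j)"
        using i nm v(1) by (simp add: E_def scalar_prod_def)
      also have "\<dots> = (\<Sum>j = 0..<n. if i = j then v $ j else 0)" by (rule sum.cong) auto
      also have "\<dots> = v $ i" using i by simp
      finally show "v $ i = 0\<^sub>v n $ i" using v i nm by simp
    qed (use v in auto)
    then show ?thesis by (auto simp: full_col_rank_def E_def)
  qed
  have "Y = N * E"
  proof (rule eq_matI)
    fix i j assume "i < dim_row (N * E)" "j < dim_col (N * E)"
    then have ij: "i < m" "j < n" using Nc by (auto simp: E_def)
    have "(N * E) $$ (i, j) = (\<Sum>l = 0..<m. N $$ (i, l) * (if l = j then 1 else 0))"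
      using ij Nc nm by (simp add: E_def scalar_prod_def)
    also have "\<dots> = (\<Sum>l = 0..<m. if l = j then N $$ (i, l) else 0)" by (rule sum.cong) auto
    also have "\<dots> = N $$ (i, j)" using ij nm by simp
    finally show "Y $$ (i, j) = (N * E) $$ (i, j)" using ij by (simp add: Y_def)
  qed (use Nc in \<open>auto simp: Y_def E_def\<close>)
  then have Y: "Y \<in> full_col_rank m n" using full_col_rank_mult[OF NU(1) E] by simp
  have "X = Y * A"
  proof (rule eq_matI)
    fix i j assume "i < dim_row (Y * A)" "j < dim_col (Y * A)"
    then have ij: "i < m" "j < n" by (auto simp: Y_def A_def)
    then have jm: "j < m" using nm by simp
    have "X $$ (i, j) = (N * U) $$ (i, j)" using ij jm NU(4)[symmetric] by (simp add: M_def)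
    also have "\<dots> = (\<Sum>l = 0..<m. N $$ (i, l) * U $$ (l, j))"
      using ij jm Nc NU(2) by (simp add: scalar_prod_def)
    \<comment> \<open>For a column index \<open>j < n\<close>, triangularity annihilates the rows of
      \<open>U\<close> from \<open>n\<close> on.\<close>
    also have "\<dots> = (\<Sum>l = 0..<n. N $$ (i, l) * U $$ (l, j))"
      using nm ij NU(2) upper_triangularD[OF NU(3)]
      by (intro sum.mono_neutral_right) (auto simp: not_less)
    also have "\<dots> = (Y * A) $$ (i, j)" using ij by (simp add: Y_def A_def scalar_prod_def)
    finally show "X $$ (i, j) = (Y * A) $$ (i, j)" .
  qed (use X in \<open>auto simp: Y_def A_def\<close>)
  then show thesis by (intro that[OF Y]) (auto simp: A_def)
qed

section \<open>Counting\<close>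

lemma card_carrier_vec:
  assumes "finite (UNIV :: 'a set)"
  shows "finite (carrier_vec n :: 'a vec set)"
    and "card (carrier_vec n :: 'a vec set) = card (UNIV :: 'a set) ^ n"
proof -
  have b: "bij_betw (vec n) ({..<n} \<rightarrow>\<^sub>E (UNIV :: 'a set)) (carrier_vec n)"
  proof (rule bij_betw_byWitness[where f' = "\<lambda>v. restrict (\<lambda>i. v $ i) {..<n}"])
    show "\<forall>f\<in>{..<n} \<rightarrow>\<^sub>E (UNIV :: 'a set). restrict (\<lambda>i. vec n f $ i) {..<n} = f"
      by (auto simp: fun_eq_iff PiE_def extensional_def)
    show "\<forall>v\<in>carrier_vec n. vec n (restrict (($) v) {..<n}) = v"
      by (intro ballI eq_vecI) auto
    show "vec n ` ({..<n} \<rightarrow>\<^sub>E (UNIV :: 'a set)) \<subseteq> carrier_vec n"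
      by (rule image_subsetI) simp
    show "(\<lambda>v. restrict (($) v) {..<n}) ` carrier_vec n \<subseteq> {..<n} \<rightarrow>\<^sub>E (UNIV :: 'a set)"
      by (rule image_subsetI) (simp add: PiE_iff)
  qed
  have "finite ({..<n} \<rightarrow>\<^sub>E (UNIV :: 'a set))" using assms by (intro finite_PiE) auto
  then show "finite (carrier_vec n :: 'a vec set)" using bij_betw_finite[OF b] by simp
  show "card (carrier_vec n :: 'a vec set) = card (UNIV :: 'a set) ^ n"
    using bij_betw_same_card[OF b] by (simp add: card_PiE)
qed

lemma finite_carrier_mat:
  assumes "finite (UNIV :: 'a set)"
  shows "finite (carrier_mat m n :: 'a mat set)"
proof -
  have "carrier_mat m n \<subseteq> mat m n ` (({..<m} \<times> {..<n}) \<rightarrow>\<^sub>E (UNIV :: 'a set))"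
  proof
    fix X :: "'a mat" assume "X \<in> carrier_mat m n"
    then have "X = mat m n (restrict (($$) X) ({..<m} \<times> {..<n}))"
      by (intro eq_matI) auto
    moreover have "restrict (($$) X) ({..<m} \<times> {..<n}) \<in> ({..<m} \<times> {..<n}) \<rightarrow>\<^sub>E UNIV"
      by simp
    ultimately show "X \<in> mat m n ` (({..<m} \<times> {..<n}) \<rightarrow>\<^sub>E (UNIV :: 'a set))"
      by (rule image_eqI)
  qed
  then show ?thesis
    by (rule finite_subset) (use assms in \<open>auto intro!: finite_imageI finite_PiE\<close>)
qed

section \<open>Counting matrices of full column rank one column at a time\<close>

definition append_col :: "nat \<Rightarrow> nat \<Rightarrow> 'a mat \<Rightarrow> 'a vec \<Rightarrow> 'a mat" where
  "append_col m k X x = mat m (Suc k) (\<lambda>(i, j). if j < k then X $$ (i, j) else x $ i)"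

lemma append_col_mult_vec:
  fixes X :: "'a::comm_semiring_0 mat"
  assumes "X \<in> carrier_mat m k" "x \<in> carrier_vec m" "w \<in> carrier_vec (Suc k)"
  shows "append_col m k X x *\<^sub>v w = X *\<^sub>v vec k (\<lambda>i. w $ i) + w $ k \<cdot>\<^sub>v x"
  by (rule eq_vecI) (use assms in \<open>auto simp: append_col_def scalar_prod_def mult.commute\<close>)

lemma append_col_inj:
  assumes "X \<in> carrier_mat m k" "Y \<in> carrier_mat m k" "x \<in> carrier_vec m" "y \<in> carrier_vec m"
    and eq: "append_col m k X x = append_col m k Y y"
  shows "X = Y \<and> x = y"
proof -
  have e: "append_col m k X x $$ (i, j) = append_col m k Y y $$ (i, j)" for i j using eq by simp
  have "X $$ (i, j) = Y $$ (i, j)" if "i < m" "j < k" for i j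
    using e[of i j] that by (simp add: append_col_def)
  moreover have "x $ i = y $ i" if "i < m" for i
    using e[of i k] that by (simp add: append_col_def)
  ultimately show ?thesis using assms by (auto intro!: eq_matI eq_vecI)
qed

text \<open>Appending a column preserves the trivial kernel exactly when the new column lies outside
  the column space of the others. This is the recursion behind the count.\<close>

lemma full_col_rank_Suc:
  "(full_col_rank m (Suc k) :: 'a::field mat set) = (\<lambda>(X, x). append_col m k X x) `
     (SIGMA X : full_col_rank m k. carrier_vec m - (*\<^sub>v) X ` carrier_vec k)" (is "?L = ?R")
proof (intro equalityI subsetI)
  fix Z :: "'a mat" assume Z: "Z \<in> ?L"
  define X where "X = mat m k (\<lambda>(i, j). Z $$ (i, j))"
  define x where "x = col Z k"
  have Zc: "Z \<in> carrier_mat m (Suc k)" using Z by (rule full_col_rank_carrier)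
  have Xc: "X \<in> carrier_mat m k" and xc: "x \<in> carrier_vec m" using Zc by (auto simp: X_def x_def)
  have ZX: "Z = append_col m k X x"
    using Zc by (intro eq_matI) (auto simp: append_col_def X_def x_def less_Suc_eq)
  note mult = append_col_mult_vec[OF Xc xc, folded ZX]
  have "u = 0\<^sub>v k" if u: "u \<in> carrier_vec k" "X *\<^sub>v u = 0\<^sub>v m" for u
  proof -
    define w where "w = vec (Suc k) (\<lambda>i. if i < k then u $ i else 0)"
    have w: "w \<in> carrier_vec (Suc k)" "vec k (\<lambda>i. w $ i) = u" "w $ k = 0"
      using u(1) by (auto simp: w_def)
    have "Z *\<^sub>v w = 0\<^sub>v m" using mult[OF w(1)] w u xc by (auto intro!: eq_vecI)
    then have "w = 0\<^sub>v (Suc k)" using full_col_rankD[OF Z w(1)] by simp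
    then show ?thesis using w(2) by (auto intro!: eq_vecI)
  qed
  then have X: "X \<in> full_col_rank m k" using Xc by (auto simp: full_col_rank_def)
  have "x \<noteq> X *\<^sub>v u" if u: "u \<in> carrier_vec k" for u
  proof
    assume xu: "x = X *\<^sub>v u"
    \<comment> \<open>The last entry \<open>- 1\<close> turns a representation of \<open>x\<close>
      by the columns of \<open>X\<close> into a kernel vector of \<open>Z\<close>.\<close>
    define w where "w = vec (Suc k) (\<lambda>i. if i < k then u $ i else - 1)"
    have w: "w \<in> carrier_vec (Suc k)" "vec k (\<lambda>i. w $ i) = u" "w $ k = - 1"
      using u by (auto simp: w_def)
    have "Z *\<^sub>v w = x + - 1 \<cdot>\<^sub>v x" using mult[OF w(1)] w(2,3) xu by metis
    also have "\<dots> = 0\<^sub>v m" using xc by (intro eq_vecI) auto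
    finally have "Z *\<^sub>v w = 0\<^sub>v m" .
    then have "w = 0\<^sub>v (Suc k)" using full_col_rankD[OF Z w(1)] by simp
    then show False using w(3) by simp
  qed
  then have "(X, x) \<in> (SIGMA X : full_col_rank m k. carrier_vec m - (*\<^sub>v) X ` carrier_vec k)"
    using X xc by auto
  then show "Z \<in> ?R" using ZX by (auto intro!: image_eqI[of _ _ "(X, x)"])
next
  fix Z :: "'a mat" assume "Z \<in> ?R"
  then obtain X x where X: "X \<in> full_col_rank m k" and xc: "x \<in> carrier_vec m"
    and nin: "x \<notin> (*\<^sub>v) X ` carrier_vec k" and Z: "Z = append_col m k X x" by auto
  have Xc: "X \<in> carrier_mat m k" using X by (rule full_col_rank_carrier)
  have "w = 0\<^sub>v (Suc k)" if w: "w \<in> carrier_vec (Suc k)" "Z *\<^sub>v w = 0\<^sub>v m" for w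
  proof -
    define u where "u = vec k (\<lambda>i. w $ i)"
    have u: "u \<in> carrier_vec k" by (simp add: u_def)
    have Xu: "X *\<^sub>v u \<in> carrier_vec m" using Xc u by (rule mult_mat_vec_carrier)
    have "X *\<^sub>v u + w $ k \<cdot>\<^sub>v x = 0\<^sub>v m"
      using append_col_mult_vec[OF Xc xc w(1)] w(2) by (simp add: Z u_def)
    then have e: "(X *\<^sub>v u) $ i + w $ k * x $ i = 0" if "i < m" for i
      using arg_cong[of _ _ "\<lambda>v. v $ i"] that Xu xc Xc by (metis carrier_vecD index_add_vec(1)
          index_smult_vec index_zero_vec(1))
    have wk: "w $ k = 0"
    proof (rule ccontr)
      assume nz: "w $ k \<noteq> 0"
      \<comment> \<open>A nonzero last coordinate allows the kernel relation to be solved for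
        \<open>x\<close>.\<close>
      have "x = X *\<^sub>v ((- 1 / w $ k) \<cdot>\<^sub>v u)"
      proof (rule eq_vecI)
        fix i assume "i < dim_vec (X *\<^sub>v ((- 1 / w $ k) \<cdot>\<^sub>v u))"
        then have i: "i < m" using Xc by simp
        have "(X *\<^sub>v ((- 1 / w $ k) \<cdot>\<^sub>v u)) $ i = (- 1 / w $ k) * (X *\<^sub>v u) $ i"
          using mult_mat_vec[OF Xc u] Xc i by simp
        also have "(X *\<^sub>v u) $ i = - (w $ k * x $ i)" using e[OF i] by (simp add: eq_neg_iff_add_eq_0)
        also have "- 1 / w $ k * - (w $ k * x $ i) = x $ i" using nz by simp
        finally show "x $ i = (X *\<^sub>v ((- 1 / w $ k) \<cdot>\<^sub>v u)) $ i" by simp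
      qed (use xc Xc in auto)
      then show False using nin u by auto
    qed
    then have "X *\<^sub>v u = 0\<^sub>v m" using e Xc by (intro eq_vecI) auto
    then have "u = 0\<^sub>v k" using full_col_rankD[OF X u] by simp
    then have "w $ i = 0" if "i < k" for i
      using that by (metis index_vec index_zero_vec(1) u_def)
    then show ?thesis using wk w(1) by (intro eq_vecI) (auto simp: less_Suc_eq)
  qed
  then show "Z \<in> ?L" by (auto simp: full_col_rank_def Z append_col_def)
qed

lemma finite_full_col_rank:
  "finite (UNIV :: 'a::field set) \<Longrightarrow> finite (full_col_rank m n :: 'a mat set)"
  by (rule finite_subset[OF _ finite_carrier_mat[of m n]]) (auto simp: full_col_rank_carrier)

text \<open>After \<open>i\<close> independent columns, the \<open>q ^ i\<close> vectors of their
  span are excluded for the next one. Truncated subtraction is harmless: if \<open>k > m\<close>,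
  the factor for \<open>i = m\<close> is zero, as is the number of such matrices.\<close>

lemma card_full_col_rank:
  assumes fin: "finite (UNIV :: 'a::field set)"
  shows "card (full_col_rank m k :: 'a mat set)
    = (\<Prod>i<k. card (UNIV :: 'a set) ^ m - card (UNIV :: 'a set) ^ i)"
proof (induction k)
  case 0
  have "(full_col_rank m 0 :: 'a mat set) = {mat m 0 (\<lambda>_. 0)}"
    by (auto simp: full_col_rank_def intro!: eq_matI eq_vecI)
  then show ?case by simp
next
  case (Suc k)
  let ?q = "card (UNIV :: 'a set)"
  let ?V = "\<lambda>X :: 'a mat. carrier_vec m - (*\<^sub>v) X ` carrier_vec k"
  have inj: "inj_on (\<lambda>(X, x). append_col m k X x) (SIGMA X : full_col_rank m k. ?V X)"
  proof (rule inj_onI, clarify)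
    fix X Y :: "'a mat" and x y :: "'a vec"
    assume "X \<in> full_col_rank m k" "Y \<in> full_col_rank m k" "x \<in> carrier_vec m" "y \<in> carrier_vec m"
      "append_col m k X x = append_col m k Y y"
    then show "X = Y \<and> x = y" by (intro append_col_inj full_col_rank_carrier)
  qed
  have "card (?V X) = ?q ^ m - ?q ^ k" if X: "X \<in> full_col_rank m k" for X
  proof -
    have "card ((*\<^sub>v) X ` carrier_vec k) = ?q ^ k"
      using card_image[OF full_col_rank_inj_on[OF X]] card_carrier_vec[OF fin] by metis
    moreover have "(*\<^sub>v) X ` carrier_vec k \<subseteq> carrier_vec m"
      using mult_mat_vec_carrier[OF full_col_rank_carrier[OF X]] by blast
    ultimately show ?thesis
      using card_carrier_vec[OF fin] by (simp add: card_Diff_subset)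
  qed
  then have "card (SIGMA X : full_col_rank m k. ?V X)
      = card (full_col_rank m k :: 'a mat set) * (?q ^ m - ?q ^ k)"
    using finite_full_col_rank[OF fin] card_carrier_vec[OF fin] by (subst card_SigmaI) auto
  then show ?case
    unfolding full_col_rank_Suc card_image[OF inj] by (simp add: Suc.IH)
qed

text \<open>Every factor \<open>q ^ l - q ^ i\<close> is \<open>q ^ i * (q - 1)\<close> times the
  q-integer of \<open>l - i\<close>. The first part does not depend on \<open>l\<close>, so the
  quotient for \<open>l = m\<close> and \<open>l = n\<close> is a quotient of q-factorials.\<close>

lemma q_binomial_eq_quotient:
  fixes q :: real
  assumes q: "q > 1" and nm: "n \<le> m"
  shows "q_binomial q m n * (\<Prod>i<n. q ^ n - q ^ i) = (\<Prod>i<n. q ^ m - q ^ i)"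
proof -
  \<comment> \<open>\<open>b i\<close> is the q-integer of \<open>i\<close>; it is positive for
    \<open>i > 0\<close>, so the q-factorials can be cancelled.\<close>
  define b where "b i = (\<Sum>j<i. q ^ j)" for i
  have b: "(q - 1) * b i = q ^ i - 1" for i
    unfolding b_def using power_diff_1_eq[of q i] by simp
  have b0: "b i > 0" if "i > 0" for i
    unfolding b_def using that q by (intro sum_pos) auto
  have fact0: "q_fact q k \<noteq> 0" for k
  proof -
    have "(\<Prod>i=1..k. b i) > 0" by (rule prod_pos) (simp add: b0)
    moreover have "q_fact q k = (\<Prod>i=1..k. b i)" unfolding q_fact_def b_def ..
    ultimately show ?thesis by linarith
  qed
  have fact_split: "q_fact q (k + n) = q_fact q k * (\<Prod>i<n. b (k + n - i))" for k n
  proof (induction n)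
    case (Suc n)
    have "(\<Prod>i<Suc n. b (k + Suc n - i)) = b (k + Suc n) * (\<Prod>i<n. b (k + n - i))"
      by (simp only: prod.lessThan_Suc_shift) simp
    moreover have "q_fact q (k + Suc n) = q_fact q (k + n) * b (k + Suc n)"
      by (simp add: q_fact_def b_def)
    ultimately show ?case using Suc by simp
  qed simp
  have prod: "(\<Prod>i<n. q ^ l - q ^ i) = (\<Prod>i<n. q ^ i * (q - 1)) * (\<Prod>i<n. b (l - i))" if "n \<le> l" for l
    unfolding prod.distrib[symmetric]
  proof (rule prod.cong)
    fix i assume "i \<in> {..<n}"
    then have "q ^ l = q ^ i * q ^ (l - i)" using that by (simp flip: power_add)
    then show "q ^ l - q ^ i = q ^ i * (q - 1) * b (l - i)"
      using b[of "l - i"] by (simp only: mult.assoc) (simp add: algebra_simps)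
  qed simp
  have "q_fact q m = q_fact q (m - n) * (\<Prod>i<n. b (m - i))"
    using fact_split[of "m - n" n] nm by simp
  moreover have "q_fact q n = (\<Prod>i<n. b (n - i))"
    using fact_split[of 0 n] by (simp add: q_fact_def)
  ultimately have "q_binomial q m n * (\<Prod>i<n. b (n - i)) = (\<Prod>i<n. b (m - i))"
    unfolding q_binomial_def using fact0[of "m - n"] fact0[of n] by (simp add: field_simps)
  then show ?thesis unfolding prod[OF nm] prod[OF order_refl] by (simp add: mult_ac)
qed

section \<open>Transposition\<close>

lemma semigroup_generates_anti_image:
  assumes gen: "semigroup_generates f S A"
    and anti: "\<And>x y. x \<in> S \<Longrightarrow> y \<in> S \<Longrightarrow> \<phi> (f x y) = g (\<phi> y) (\<phi> x)"
  shows "semigroup_generates g (\<phi> ` S) (\<phi> ` A)"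
proof -
  have S: "semigroup_closure f A = S" and A: "A \<subseteq> S"
    using gen by (auto simp: semigroup_generates_def)
  have "\<phi> x \<in> semigroup_closure g (\<phi> ` A)" if "x \<in> semigroup_closure f A" for x
    using that
  proof induction
    case (mult x y)
    then have "\<phi> (f x y) = g (\<phi> y) (\<phi> x)" using S anti by simp
    then show ?case using mult.IH semigroup_closure.mult[of "\<phi> y" g "\<phi> ` A"] by simp
  qed (auto intro: semigroup_closure.base)
  moreover have "y \<in> \<phi> ` S" if "y \<in> semigroup_closure g (\<phi> ` A)" for y
    using that
  proof induction
    case (mult x y)
    then obtain u v where "u \<in> S" "v \<in> S" "x = \<phi> u" "y = \<phi> v" by auto
    then have "g x y = \<phi> (f v u)" "f v u \<in> S"
      using anti S semigroup_closure.mult[of v f A u] by auto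
    then show ?case by blast
  qed (use A in auto)
  ultimately show ?thesis using A S by (auto simp: semigroup_generates_def)
qed

text \<open>Generating sets are carried over in both directions with their cardinality, so the
  predicates under \<open>LEAST\<close> agree for every \<open>k\<close>.\<close>

lemma semigroup_rank_anti_iso:
  assumes \<phi>: "\<And>x y. x \<in> S \<Longrightarrow> y \<in> S \<Longrightarrow> \<phi> (f x y) = g (\<phi> y) (\<phi> x)"
    and \<psi>: "\<And>x y. x \<in> S' \<Longrightarrow> y \<in> S' \<Longrightarrow> \<psi> (g x y) = f (\<psi> y) (\<psi> x)"
    and img: "\<phi> ` S = S'" "\<psi> ` S' = S"
    and inj: "inj_on \<phi> S" "inj_on \<psi> S'"
  shows "semigroup_rank f S = semigroup_rank g S'"
proof -
  have "(\<exists>A. semigroup_generates f S A \<and> finite A \<and> card A = k)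
      \<longleftrightarrow> (\<exists>A. semigroup_generates g S' A \<and> finite A \<and> card A = k)" (is "?L \<longleftrightarrow> ?R") for k
  proof
    assume ?L
    then obtain A where A: "semigroup_generates f S A" "finite A" "card A = k" by auto
    then have "card (\<phi> ` A) = k"
      using card_image[OF inj_on_subset[OF inj(1)]] by (auto simp: semigroup_generates_def)
    moreover have "semigroup_generates g S' (\<phi> ` A)"
      using semigroup_generates_anti_image[where \<phi> = \<phi>, OF A(1) \<phi>] img by simp
    ultimately show ?R using A(2) by blast
  next
    assume ?R
    then obtain A where A: "semigroup_generates g S' A" "finite A" "card A = k" by auto
    then have "card (\<psi> ` A) = k"
      using card_image[OF inj_on_subset[OF inj(2)]] by (auto simp: semigroup_generates_def)
    moreover have "semigroup_generates f S (\<psi> ` A)"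
      using semigroup_generates_anti_image[where \<phi> = \<psi>, OF A(1) \<psi>] img by simp
    ultimately show ?L using A(2) by blast
  qed
  then show ?thesis unfolding semigroup_rank_def by simp
qed

lemma transpose_sandwich_J:
  assumes "r \<le> m" "r \<le> n"
  shows "transpose_mat (sandwich_J m n r) = sandwich_J n m r"
  using assms by (intro eq_matI) (auto simp: sandwich_J_def)

lemma transpose_sandwich_mult:
  fixes J :: "'a::field mat"
  assumes J: "J \<in> carrier_mat n m" and X: "X \<in> carrier_mat m n" and Y: "Y \<in> carrier_mat m n"
  shows "transpose_mat (sandwich_mult J X Y)
    = sandwich_mult (transpose_mat J) (transpose_mat Y) (transpose_mat X)"
proof -
  have "transpose_mat (X * J * Y) = transpose_mat Y * (transpose_mat J * transpose_mat X)"
    using transpose_mult[OF mult_carrier_mat[OF X J] Y] transpose_mult[OF X J] by simp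
  also have "\<dots> = transpose_mat Y * transpose_mat J * transpose_mat X"
    by (rule assoc_mult_mat[symmetric]) (use J X Y in auto)
  finally show ?thesis by (simp add: sandwich_mult_def)
qed

lemma semigroup_rank_sandwich_transpose:
  assumes r: "r \<le> m" "r \<le> n"
  shows "semigroup_rank (sandwich_mult (sandwich_J m n r :: 'a::field mat)) (carrier_mat m n)
    = semigroup_rank (sandwich_mult (sandwich_J n m r :: 'a mat)) (carrier_mat n m)"
proof (rule semigroup_rank_anti_iso[where \<phi> = transpose_mat and \<psi> = transpose_mat])
  have img: "transpose_mat ` carrier_mat a b = (carrier_mat b a :: 'a mat set)" for a b
    by (auto intro: image_eqI[of _ transpose_mat "transpose_mat _"])
  show "transpose_mat ` carrier_mat m n = (carrier_mat n m :: 'a mat set)"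
    "transpose_mat ` carrier_mat n m = (carrier_mat m n :: 'a mat set)" by (fact img)+
qed (use r in \<open>auto simp: inj_on_def transpose_sandwich_mult[OF sandwich_J_carrier]
      transpose_sandwich_J\<close>)

section \<open>Orbits of the general linear group\<close>

text \<open>This is the orbit of \<open>X\<close> under right multiplication by the general linear
  group. For \<open>X\<close> of full column rank it consists of all matrices of that format with
  the same column space, so such orbits correspond to the \<open>n\<close>-dimensional
  subspaces.\<close>

definition col_space_class :: "nat \<Rightarrow> 'a::field mat \<Rightarrow> 'a mat set" where
  "col_space_class n X = (\<lambda>A. X * A) ` full_col_rank n n"

lemma col_space_class_self: "X \<in> carrier_mat m n \<Longrightarrow> X \<in> col_space_class n X"
  using one_full_col_rank[of n] by (auto simp: col_space_class_def intro!: image_eqI[of _ _ "1\<^sub>m n"])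

lemma col_space_class_subset: "X \<in> full_col_rank m n \<Longrightarrow> col_space_class n X \<subseteq> full_col_rank m n"
  by (auto simp: col_space_class_def full_col_rank_mult)

lemma col_space_class_mult:
  assumes X: "X \<in> carrier_mat m n" and A: "A \<in> full_col_rank n n"
  shows "col_space_class n (X * A) = col_space_class n X"
proof -
  have Ac: "A \<in> carrier_mat n n" using A by (rule full_col_rank_carrier)
  obtain B where B: "B \<in> full_col_rank n n" "A * B = 1\<^sub>m n"
    using full_col_rank_obtain_inverse[OF A] by blast
  have Bc: "B \<in> carrier_mat n n" using B(1) by (rule full_col_rank_carrier)
  have "X * A * C = X * (A * C)" if "C \<in> full_col_rank n n" for C
    using assoc_mult_mat[OF X Ac full_col_rank_carrier[OF that]] .
  moreover have "X * C = X * A * (B * C)" if "C \<in> full_col_rank n n" for C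
  proof -
    have Cc: "C \<in> carrier_mat n n" using that by (rule full_col_rank_carrier)
    have "X * A * (B * C) = X * (A * (B * C))"
      by (rule assoc_mult_mat[OF X Ac]) (use Bc Cc in auto)
    also have "A * (B * C) = C"
      using assoc_mult_mat[OF Ac Bc Cc] B(2) Cc by simp
    finally show ?thesis ..
  qed
  ultimately show ?thesis
    using full_col_rank_mult[OF A] full_col_rank_mult[OF B(1)]
    by (fastforce simp: col_space_class_def)
qed

lemma col_space_class_eq:
  assumes "X \<in> carrier_mat m n" and "Y \<in> col_space_class n X"
  shows "col_space_class n Y = col_space_class n X"
  using assms col_space_class_mult[OF assms(1)] by (auto simp: col_space_class_def)

text \<open>The action is free, because a matrix of full column rank can be cancelled on the
  left.\<close>

lemma card_col_space_class:
  fixes X :: "'a::field mat"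
  assumes X: "X \<in> full_col_rank m n"
  shows "card (col_space_class n X) = card (full_col_rank n n :: 'a mat set)"
  unfolding col_space_class_def
proof (intro card_image inj_onI)
  fix A B assume "A \<in> full_col_rank n n" "B \<in> full_col_rank n n" "X * A = X * B"
  then show "A = B"
    using full_col_rank_cancel[OF X full_col_rank_carrier full_col_rank_carrier] by blast
qed

text \<open>The classes partition the matrices of full column rank into parts of the size of the
  general linear group; the quotient of the two counts is the q-binomial coefficient.\<close>

lemma card_col_space_classes:
  fixes m n :: nat
  defines "\<C> \<equiv> col_space_class n ` (full_col_rank m n :: 'a::field mat set)"
  assumes fin: "finite (UNIV :: 'a set)" and nm: "n \<le> m"
  shows "real (card \<C>) = q_binomial (real (card (UNIV :: 'a set))) m n"
proof -
  let ?q = "card (UNIV :: 'a set)"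
  have "card {0, 1 :: 'a} \<le> ?q" using fin by (intro card_mono) auto
  then have q: "?q > 1" by simp
  have U: "\<Union>\<C> = full_col_rank m n"
    using col_space_class_subset[of _ m n] col_space_class_self[OF full_col_rank_carrier, of _ m n]
    by (fastforce simp: \<C>_def)
  have "card (full_col_rank n n :: 'a mat set) * card \<C> = card (\<Union>\<C>)"
  proof (rule card_partition)
    show "finite \<C>" "finite (\<Union>\<C>)"
      unfolding U unfolding \<C>_def using finite_full_col_rank[OF fin] by auto
    show "card C = card (full_col_rank n n :: 'a mat set)" if "C \<in> \<C>" for C
      using that card_col_space_class by (auto simp: \<C>_def)
    show "C \<inter> D = {}" if "C \<in> \<C>" "D \<in> \<C>" "C \<noteq> D" for C D
    proof (rule ccontr)
      assume "C \<inter> D \<noteq> {}"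
      then obtain Z where "Z \<in> C" "Z \<in> D" by auto
      with that show False
        using col_space_class_eq[OF full_col_rank_carrier, of _ m n Z] by (auto simp: \<C>_def)
    qed
  qed
  then have "real (\<Prod>i<n. ?q ^ n - ?q ^ i) * real (card \<C>) = real (\<Prod>i<n. ?q ^ m - ?q ^ i)"
    unfolding U card_full_col_rank[OF fin] by (metis of_nat_mult)
  \<comment> \<open>The subtraction of naturals is exact here, because \<open>i < n\<close> and
    \<open>n \<le> l\<close>.\<close>
  moreover have "real (\<Prod>i<n. ?q ^ l - ?q ^ i) = (\<Prod>i<n. real ?q ^ l - real ?q ^ i)" if "n \<le> l" for l
    unfolding of_nat_prod using q that by (intro prod.cong) (auto simp: of_nat_diff power_increasing)
  ultimately have e: "(\<Prod>i<n. real ?q ^ n - real ?q ^ i) * real (card \<C>)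
      = (\<Prod>i<n. real ?q ^ m - real ?q ^ i)"
    using nm by simp
  have "(\<Prod>i<n. real ?q ^ n - real ?q ^ i) \<noteq> 0" using q by (simp add: prod_zero_iff)
  then show ?thesis
    using e q_binomial_eq_quotient[of "real ?q" n m] q nm by (metis mult.commute mult_cancel_left of_nat_1 of_nat_less_iff)
qed

text \<open>Conjugation with the transposition of \<open>0\<close> and \<open>k\<close> moves the
  special column to position \<open>0\<close> and permutes its entries, so that the pivot becomes
  \<open>w $ 0 = v $ k\<close>.\<close>

lemma eta_mat_conjugate_swap:
  fixes v :: "'a::comm_ring_1 vec"
  assumes k: "0 < k" "k < n" and v: "v \<in> carrier_vec n"
  defines "w \<equiv> vec n (\<lambda>i. v $ (if i = 0 then k else if i = k then 0 else i))"
  shows "eta_mat n k v = swaprows_mat n 0 k * eta_mat n 0 w * swaprows_mat n 0 k"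
proof -
  have n0: "0 < n" using k by simp
  have "swaprows_mat n 0 k * eta_mat n 0 w * swaprows_mat n 0 k
      = swapcols 0 k (swaprows 0 k (eta_mat n 0 w))"
    unfolding swaprows_mat[OF eta_mat_carrier n0 k(2)]
    by (rule swapcols_mat[OF mult_carrier_mat[OF swaprows_mat_carrier eta_mat_carrier] n0 k(2), symmetric])
  also have "\<dots> = eta_mat n k v"
    using k v by (intro eq_matI) (auto simp: eta_mat_def w_def)
  finally show ?thesis ..
qed

text \<open>The predicate \<open>P\<close> restricts the pivot, which conjugation preserves. It
  allows one argument for the invertible eta matrices and for all of them.\<close>

lemma eta_mat_mem_if_swaps:
  fixes T :: "'a::comm_ring_1 mat set"
  assumes mult: "\<And>A B. A \<in> T \<Longrightarrow> B \<in> T \<Longrightarrow> A * B \<in> T"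
    and swap: "\<And>i. 0 < i \<Longrightarrow> i < n \<Longrightarrow> swaprows_mat n 0 i \<in> T"
    and eta: "\<And>w. w \<in> carrier_vec n \<Longrightarrow> P (w $ 0) \<Longrightarrow> eta_mat n 0 w \<in> T"
    and k: "k < n" and v: "v \<in> carrier_vec n" "P (v $ k)"
  shows "eta_mat n k v \<in> T"
proof (cases "k = 0")
  case True
  then show ?thesis using eta v by simp
next
  case False
  then show ?thesis
    using eta_mat_conjugate_swap[OF _ k v(1)] k v by (auto intro!: mult swap eta)
qed

section \<open>The semigroup of tall matrices\<close>

locale tall_sandwich =
  fixes m n :: nat and J :: "'a::field mat"
  assumes n0: "0 < n" and nm: "n < m" and fin: "finite (UNIV :: 'a set)"
    and J_def: "J = sandwich_J m n n"
begin

lemma J_carrier: "J \<in> carrier_mat n m"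
  using sandwich_J_carrier[of n m n] nm by (simp add: J_def)

lemma J_mult:
  assumes X: "X \<in> carrier_mat m k"
  shows "J * X = mat n k (\<lambda>(i, j). X $$ (i, j))"
proof (rule eq_matI)
  fix i j assume "i < dim_row (mat n k (\<lambda>(i, j). X $$ (i, j)))" "j < dim_col (mat n k (\<lambda>(i, j). X $$ (i, j)))"
  then have ij: "i < n" "j < k" by auto
  have "(J * X) $$ (i, j) = (\<Sum>l = 0..<m. J $$ (i, l) * X $$ (l, j))"
    using ij X J_carrier by (simp add: scalar_prod_def)
  also have "\<dots> = (\<Sum>l = 0..<m. if l = i then X $$ (l, j) else 0)"
    using ij nm by (intro sum.cong) (auto simp: J_def sandwich_J_def)
  also have "\<dots> = X $$ (i, j)" using ij nm by simp
  finally show "(J * X) $$ (i, j) = mat n k (\<lambda>(i, j). X $$ (i, j)) $$ (i, j)" using ij by simp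
qed (use X J_carrier in auto)

lemma J_mult_carrier: "X \<in> carrier_mat m n \<Longrightarrow> J * X \<in> carrier_mat n n"
  using J_carrier by auto

lemma sandwich_mult_eq:
  assumes "X \<in> carrier_mat m n" "Y \<in> carrier_mat m n"
  shows "sandwich_mult J X Y = X * (J * Y)"
  unfolding sandwich_mult_def using assoc_mult_mat[OF assms(1) J_carrier assms(2)] .

lemma full_col_rank_if_top:
  assumes X: "X \<in> carrier_mat m n" and JX: "J * X \<in> full_col_rank n n"
  shows "X \<in> full_col_rank m n"
proof -
  have "v = 0\<^sub>v n" if v: "v \<in> carrier_vec n" "X *\<^sub>v v = 0\<^sub>v m" for v
  proof -
    have "J * X *\<^sub>v v = J *\<^sub>v 0\<^sub>v m" using assoc_mult_mat_vec[OF J_carrier X v(1)] v(2) by simp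
    also have "\<dots> = 0\<^sub>v n" using J_carrier by auto
    finally show ?thesis using full_col_rankD[OF JX v(1)] by simp
  qed
  then show ?thesis using X by (auto simp: full_col_rank_def)
qed

section \<open>The lower bound: a generator in every orbit\<close>

definition col_space_classes :: "'a mat set set" where
  "col_space_classes = col_space_class n ` full_col_rank m n"

lemma finite_col_space_classes: "finite col_space_classes"
  unfolding col_space_classes_def using finite_full_col_rank[OF fin] by simp

text \<open>If a product has full column rank, the upper block of its right factor is invertible, so
  the product lies in the class of its left factor. Descending along left factors ends at a
  generator.\<close>

lemma generates_meets_class:
  assumes gen: "semigroup_generates (sandwich_mult J) (carrier_mat m n) \<A>"
    and Z: "Z \<in> full_col_rank m n"
  shows "\<exists>X\<in>\<A>. col_space_class n Z = col_space_class n X"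
proof -
  have cl: "semigroup_closure (sandwich_mult J) \<A> = carrier_mat m n"
    using gen by (simp add: semigroup_generates_def)
  then have "Z \<in> semigroup_closure (sandwich_mult J) \<A>"
    using Z by (simp add: full_col_rank_carrier)
  then show ?thesis using Z
  proof induction
    case (mult X Y)
    then have X: "X \<in> carrier_mat m n" and Y: "Y \<in> carrier_mat m n" using cl by auto
    have XY: "X * (J * Y) \<in> full_col_rank m n"
      using mult.prems by (simp add: sandwich_mult_eq[OF X Y])
    note fac = full_col_rank_factors[OF XY X J_mult_carrier[OF Y]]
    show ?case
      using mult.IH(1)[OF fac(2)] col_space_class_mult[OF X fac(1)]
      by (simp add: sandwich_mult_eq[OF X Y])
  qed auto
qed

lemma card_col_space_classes_le:
  assumes gen: "semigroup_generates (sandwich_mult J) (carrier_mat m n) \<A>" and "finite \<A>"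
  shows "card col_space_classes \<le> card \<A>"
proof -
  have "col_space_classes \<subseteq> col_space_class n ` \<A>"
    using generates_meets_class[OF gen] by (fastforce simp: col_space_classes_def)
  then show ?thesis using \<open>finite \<A>\<close> by (rule surj_card_le[rotated])
qed

text \<open>The matrices \<open>graph_mat v\<close> have \<open>I\<^sub>n\<close> on top and thus lie in distinct classes, one for each
  vector \<open>v\<close>. That is just enough room to place the generators of the general linear group listed
  by \<open>gl_generator\<close>: a vector with \<open>v $ 0 \<noteq> 0\<close> indexes an eta matrix, and the unit
  vectors other than the first one index the transpositions.\<close>

definition graph_mat :: "'a vec \<Rightarrow> 'a mat" where
  "graph_mat v = mat m n (\<lambda>(i, j). if i < n then if i = j then 1 else 0 else v $ j)"

definition gl_generator :: "'a vec \<Rightarrow> 'a mat" where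
  "gl_generator v = (let i = LEAST i. v $ i \<noteq> 0 in if i = 0 then eta_mat n 0 v else swaprows_mat n 0 i)"

lemma graph_mat_carrier: "graph_mat v \<in> carrier_mat m n"
  by (simp add: graph_mat_def)

lemma J_graph_mat: "J * graph_mat v = 1\<^sub>m n"
  unfolding J_mult[OF graph_mat_carrier] using nm by (intro eq_matI) (auto simp: graph_mat_def)

lemma graph_mat_full_col_rank: "graph_mat v \<in> full_col_rank m n"
  by (intro full_col_rank_if_top graph_mat_carrier) (simp add: J_graph_mat one_full_col_rank)

text \<open>Comparing the upper blocks, which are identities, shows that the group element relating
  the two matrices is the identity. Row \<open>n\<close>, which exists because \<open>n < m\<close>,
  then reveals the vector.\<close>

lemma graph_mat_class_inj:
  assumes v: "v \<in> carrier_vec n" and w: "w \<in> carrier_vec n"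
    and eq: "col_space_class n (graph_mat v) = col_space_class n (graph_mat w)"
  shows "v = w"
proof -
  have "graph_mat v \<in> col_space_class n (graph_mat w)"
    using col_space_class_self[OF graph_mat_carrier] eq by metis
  then obtain A where A: "A \<in> full_col_rank n n" "graph_mat v = graph_mat w * A"
    by (auto simp: col_space_class_def)
  have Ac: "A \<in> carrier_mat n n" using A(1) by (rule full_col_rank_carrier)
  have "1\<^sub>m n = J * graph_mat w * A"
    using assoc_mult_mat[OF J_carrier graph_mat_carrier Ac] A(2) J_graph_mat by metis
  then have "A = 1\<^sub>m n" using Ac by (simp add: J_graph_mat)
  then have "graph_mat v = graph_mat w" using A(2) right_mult_one_mat[OF graph_mat_carrier] by simp
  moreover have "graph_mat u $$ (n, j) = u $ j" if "j < n" for u j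
    using that nm by (simp add: graph_mat_def)
  ultimately have "v $ j = w $ j" if "j < n" for j using that by metis
  then show ?thesis using v w by (intro eq_vecI) auto
qed

lemma gl_generator_full_col_rank:
  assumes v: "v \<in> carrier_vec n" "v \<noteq> 0\<^sub>v n"
  shows "gl_generator v \<in> full_col_rank n n"
proof -
  define i where "i = (LEAST i. v $ i \<noteq> 0)"
  \<comment> \<open>Entries outside the dimension are unspecified, so a nonzero entry inside it is
    needed to bound the least index.\<close>
  obtain j where j: "j < n" "v $ j \<noteq> 0"
    using v by (metis carrier_vecD eq_vecI index_zero_vec)
  have vi: "v $ i \<noteq> 0" unfolding i_def by (rule LeastI[of "\<lambda>i. v $ i \<noteq> 0"]) (rule j)
  have "i \<le> j" unfolding i_def by (rule Least_le) (rule j)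
  then have i: "i < n" using j by simp
  show ?thesis
  proof (cases "i = 0")
    case True
    then show ?thesis using vi eta_mat_full_col_rank[OF n0, of v]
      by (simp add: gl_generator_def i_def[symmetric])
  next
    case False
    have "det (swaprows_mat n 0 i :: 'a mat) = - 1"
      by (rule det_swaprows_mat[OF n0 i]) (use False in simp)
    then have "det (swaprows_mat n 0 i :: 'a mat) \<noteq> 0" by simp
    then show ?thesis
      using False full_col_rank_square_iff[of "swaprows_mat n 0 i :: 'a mat" n]
      by (simp add: gl_generator_def i_def[symmetric])
  qed
qed

lemma gl_generator_eta:
  assumes "v $ 0 \<noteq> 0" shows "gl_generator v = eta_mat n 0 v"
proof -
  have "(LEAST i. v $ i \<noteq> 0) = 0" using assms by (intro Least_equality) auto
  then show ?thesis by (simp add: gl_generator_def)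
qed

lemma gl_generator_swap:
  assumes "0 < i" "i < n" shows "gl_generator (unit_vec n i) = swaprows_mat n 0 i"
proof -
  have "(LEAST j. unit_vec n i $ j \<noteq> (0 :: 'a)) = i"
    by (rule Least_equality) (use assms in \<open>auto simp: not_less[symmetric]\<close>)
  then show ?thesis using assms by (simp add: gl_generator_def)
qed

text \<open>Multiplying \<open>graph_mat v\<close> by \<open>gl_generator v\<close> stays in its
  class and makes \<open>gl_generator v\<close> the upper block. As these classes are distinct, all
  such matrices fit into one transversal.\<close>

lemma ex_transversal:
  obtains \<A> where "\<A> \<subseteq> full_col_rank m n" "finite \<A>" "card \<A> \<le> card col_space_classes"
    and "\<And>X. X \<in> full_col_rank m n \<Longrightarrow> \<exists>Y\<in>\<A>. X \<in> col_space_class n Y"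
    and "\<And>v. v \<in> carrier_vec n \<Longrightarrow> v \<noteq> 0\<^sub>v n \<Longrightarrow> \<exists>Y\<in>\<A>. J * Y = gl_generator v"
proof -
  define e where "e v = graph_mat v * gl_generator v" for v
  define V where "V = carrier_vec n - {0\<^sub>v n :: 'a vec}"
  \<comment> \<open>The representative of a class is the prescribed matrix \<open>e v\<close> if the
    class contains one, and arbitrary otherwise.\<close>
  define t where "t C = (if \<exists>v\<in>V. e v \<in> C then e (SOME v. v \<in> V \<and> e v \<in> C) else SOME X. X \<in> C)" for C
  have g: "gl_generator v \<in> full_col_rank n n" if "v \<in> V" for v
    using gl_generator_full_col_rank that by (auto simp: V_def)
  have e: "e v \<in> full_col_rank m n" "col_space_class n (e v) = col_space_class n (graph_mat v)" if "v \<in> V" for v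
    unfolding e_def using full_col_rank_mult[OF graph_mat_full_col_rank g[OF that]]
      col_space_class_mult[OF graph_mat_carrier g[OF that]] by auto
  have Je: "J * e v = gl_generator v" if "v \<in> V" for v
    unfolding e_def
    using assoc_mult_mat[OF J_carrier graph_mat_carrier full_col_rank_carrier[OF g[OF that]], of v]
      full_col_rank_carrier[OF g[OF that]] by (simp add: J_graph_mat)
  have t: "t C \<in> C" if C: "C \<in> col_space_classes" for C
  proof (cases "\<exists>v\<in>V. e v \<in> C")
    case True
    then have "\<exists>v. v \<in> V \<and> e v \<in> C" by auto
    from someI_ex[OF this] show ?thesis using True by (simp add: t_def)
  next
    case False
    have "\<exists>X. X \<in> C"
      using C col_space_class_self[OF full_col_rank_carrier] by (fastforce simp: col_space_classes_def)
    from someI_ex[OF this] show ?thesis using False by (simp add: t_def)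
  qed
  have te: "t (col_space_class n (e v)) = e v" if v: "v \<in> V" for v
  proof -
    let ?C = "col_space_class n (e v)"
    have ev: "e v \<in> ?C" using col_space_class_self[OF full_col_rank_carrier[OF e(1)[OF v]]] .
    then have ex: "\<exists>u. u \<in> V \<and> e u \<in> ?C" using v by auto
    define u where "u = (SOME u. u \<in> V \<and> e u \<in> ?C)"
    have u: "u \<in> V" "e u \<in> ?C" unfolding u_def using someI_ex[OF ex] by auto
    have "col_space_class n (e u) = ?C"
      using col_space_class_eq[OF full_col_rank_carrier[OF e(1)[OF v]] u(2)] .
    \<comment> \<open>At most one \<open>e v\<close> lies in each class, so the choice by
      \<open>SOME\<close> returns exactly this vector.\<close>
    then have "u = v" using u(1) v e(2) by (intro graph_mat_class_inj) (auto simp: V_def)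
    then show ?thesis using ex by (auto simp: t_def u_def[symmetric])
  qed
  show thesis
  proof (rule that[of "t ` col_space_classes"])
    show "t ` col_space_classes \<subseteq> full_col_rank m n"
      using t col_space_class_subset by (fastforce simp: col_space_classes_def)
    show "finite (t ` col_space_classes)" "card (t ` col_space_classes) \<le> card col_space_classes"
      using finite_col_space_classes card_image_le by auto
  next
    fix X :: "'a mat" assume X: "X \<in> full_col_rank m n"
    let ?C = "col_space_class n X"
    have C: "?C \<in> col_space_classes" using X by (simp add: col_space_classes_def)
    have "col_space_class n (t ?C) = ?C"
      using col_space_class_eq[OF full_col_rank_carrier[OF X] t[OF C]] .
    then have "X \<in> col_space_class n (t ?C)"
      using col_space_class_self[OF full_col_rank_carrier[OF X]] by simp
    then show "\<exists>Y\<in>t ` col_space_classes. X \<in> col_space_class n Y" using C by blast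
  next
    fix v :: "'a vec" assume "v \<in> carrier_vec n" "v \<noteq> 0\<^sub>v n"
    then have v: "v \<in> V" by (simp add: V_def)
    have "e v \<in> t ` col_space_classes"
      using te[OF v] e(1)[OF v] by (force simp: col_space_classes_def intro: image_eqI[OF sym])
    then show "\<exists>Y\<in>t ` col_space_classes. J * Y = gl_generator v" using Je[OF v] by blast
  qed
qed

lemma ex_generates:
  obtains \<A> where "semigroup_generates (sandwich_mult J) (carrier_mat m n) \<A>" "finite \<A>"
    "card \<A> \<le> card col_space_classes"
proof -
  obtain \<A> where \<A>: "\<A> \<subseteq> full_col_rank m n" "finite \<A>" "card \<A> \<le> card col_space_classes"
    and rep: "\<And>X. X \<in> full_col_rank m n \<Longrightarrow> \<exists>Y\<in>\<A>. X \<in> col_space_class n Y"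
    and top: "\<And>v. v \<in> carrier_vec n \<Longrightarrow> v \<noteq> 0\<^sub>v n \<Longrightarrow> \<exists>Y\<in>\<A>. J * Y = gl_generator v"
    using ex_transversal by metis
  define S where "S = semigroup_closure (sandwich_mult J) \<A>"
  \<comment> \<open>\<open>T\<close> consists of the matrices that map \<open>S\<close> into itself
    by right multiplication. It is a monoid and contains the upper blocks of all members of
    \<open>S\<close>, so questions about \<open>S\<close> become questions about square
    matrices.\<close>
  define T where "T = {A \<in> carrier_mat n n. \<forall>X\<in>S. X * A \<in> S}"
  have SC: "X \<in> carrier_mat m n" if "X \<in> S" for X
    using that unfolding S_def
    by induction (use \<A>(1) full_col_rank_carrier sandwich_mult_closed[OF J_carrier] in auto)
  have \<A>S: "X \<in> S" if "X \<in> \<A>" for X using that unfolding S_def by (rule semigroup_closure.base)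
  have JT: "J * Y \<in> T" if Y: "Y \<in> S" for Y
    using J_mult_carrier[OF SC[OF Y]] Y sandwich_mult_eq[OF SC SC[OF Y]]
      semigroup_closure.mult[of _ "sandwich_mult J" \<A> Y] by (simp add: T_def S_def)
  have oneT: "1\<^sub>m n \<in> T" using right_mult_one_mat[OF SC] by (simp add: T_def)
  have multT: "A * B \<in> T" if "A \<in> T" "B \<in> T" for A B
  proof -
    have AB: "A \<in> carrier_mat n n" "B \<in> carrier_mat n n" using that by (auto simp: T_def)
    have "X * (A * B) \<in> S" if X: "X \<in> S" for X
      unfolding assoc_mult_mat[OF SC[OF X] AB, symmetric] using \<open>A \<in> T\<close> \<open>B \<in> T\<close> X by (simp add: T_def)
    then show ?thesis using AB by (simp add: T_def)
  qed
  have genT: "gl_generator v \<in> T" if v: "v \<in> carrier_vec n" "v \<noteq> 0\<^sub>v n" for v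
    using top[OF v] JT \<A>S by metis
  have swapT: "swaprows_mat n 0 i \<in> T" if "0 < i" "i < n" for i
    using genT[of "unit_vec n i"] gl_generator_swap[OF that] that by simp
  have eta0T: "eta_mat n 0 w \<in> T" if "w \<in> carrier_vec n" "w $ 0 \<noteq> 0" for w
  proof -
    have "w \<noteq> 0\<^sub>v n" using that(2) n0 by auto
    then show ?thesis using genT[OF that(1)] gl_generator_eta[OF that(2)] by simp
  qed
  have etaT: "eta_mat n k v \<in> T" if "k < n" "v \<in> carrier_vec n" "v $ k \<noteq> 0" for k v
    using eta_mat_mem_if_swaps[where P = "\<lambda>a. a \<noteq> 0", OF multT swapT eta0T that] by blast
  have GLT: "full_col_rank n n \<subseteq> T"
    by (rule full_col_rank_subset_eta_closed[OF oneT]) (use multT etaT in blast)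
  \<comment> \<open>Every matrix of full column rank is a representative times an invertible matrix,
    and the latter lies in \<open>T\<close>.\<close>
  have FS: "full_col_rank m n \<subseteq> S"
  proof
    fix X :: "'a mat" assume "X \<in> full_col_rank m n"
    then obtain Y A where "Y \<in> \<A>" "A \<in> full_col_rank n n" "X = Y * A"
      using rep by (fastforce simp: col_space_class_def)
    then show "X \<in> S" using GLT \<A>S by (auto simp: T_def)
  qed
  \<comment> \<open>Singular eta matrices also occur as upper blocks of matrices of full column rank, because
    there is at least one further row.\<close>
  have eta0T': "eta_mat n 0 v \<in> T" if v: "v \<in> carrier_vec n" for v
  proof -
    define Q where "Q = mat m n (\<lambda>(i, j). if i < n then eta_mat n 0 v $$ (i, j) else if j = 0 then 1 else 0)"
    have Qc: "Q \<in> carrier_mat m n" by (simp add: Q_def)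
    have JQ: "J * Q = eta_mat n 0 v"
      unfolding J_mult[OF Qc] using nm by (intro eq_matI) (auto simp: Q_def eta_mat_def)
    have "x = 0\<^sub>v n" if x: "x \<in> carrier_vec n" "Q *\<^sub>v x = 0\<^sub>v m" for x
    proof -
      \<comment> \<open>The extra row forces \<open>x $ 0 = 0\<close>, which does the work of a
        nonzero pivot: the other rows of the eta matrix then give the remaining coordinates.\<close>
      have "row Q n = unit_vec n 0"
        using nm by (intro eq_vecI) (auto simp: Q_def)
      then have "(Q *\<^sub>v x) $ n = x $ 0" using Qc nm n0 x(1) by simp
      then have x0: "x $ 0 = 0" using x(2) nm by simp
      have "J * Q *\<^sub>v x = J *\<^sub>v 0\<^sub>v m" using assoc_mult_mat_vec[OF J_carrier Qc x(1)] x(2) by simp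
      also have "\<dots> = 0\<^sub>v n" using J_carrier by auto
      finally have "(eta_mat n 0 v *\<^sub>v x) $ i = 0" if "i < n" for i using that by (simp add: JQ)
      then have "x $ i = 0" if "i < n" for i
        using index_eta_mat_mult_vec[OF that n0 x(1), of v] x0 that by (auto split: if_splits)
      then show ?thesis using x(1) by (intro eq_vecI) auto
    qed
    then have "Q \<in> full_col_rank m n" using Qc by (auto simp: full_col_rank_def)
    then show ?thesis using JT[of Q] FS JQ by auto
  qed
  have etaT': "eta_mat n k v \<in> T" if "k < n" "v \<in> carrier_vec n" for k v
    using eta_mat_mem_if_swaps[where P = "\<lambda>_. True", OF multT swapT eta0T' that] by blast
  have CT: "carrier_mat n n \<subseteq> T"
    by (rule carrier_mat_subset_eta_closed[OF oneT]) (use multT etaT' in blast)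
  have "carrier_mat m n \<subseteq> S"
  proof
    fix X :: "'a mat" assume "X \<in> carrier_mat m n"
    then obtain Y A where "Y \<in> full_col_rank m n" "A \<in> carrier_mat n n" "X = Y * A"
      using full_col_rank_factorization nm by (metis less_imp_le)
    then show "X \<in> S" using FS CT by (auto simp: T_def)
  qed
  then have "semigroup_generates (sandwich_mult J) (carrier_mat m n) \<A>"
    using SC \<A>S by (auto simp: semigroup_generates_def S_def)
  then show thesis using \<A> that by blast
qed

lemma semigroup_rank_eq:
  "semigroup_rank (sandwich_mult J) (carrier_mat m n) = card col_space_classes"
  unfolding semigroup_rank_def
proof (rule Least_equality)
  obtain \<A> where \<A>: "semigroup_generates (sandwich_mult J) (carrier_mat m n) \<A>" "finite \<A>"
    "card \<A> \<le> card col_space_classes" using ex_generates by blast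
  moreover have "card col_space_classes \<le> card \<A>" using \<A>(1,2) by (rule card_col_space_classes_le)
  ultimately show "\<exists>\<A>. semigroup_generates (sandwich_mult J) (carrier_mat m n) \<A> \<and> finite \<A>
      \<and> card \<A> = card col_space_classes" by auto
qed (use card_col_space_classes_le in auto)

lemma semigroup_rank_q_binomial:
  "real (semigroup_rank (sandwich_mult J) (carrier_mat m n))
    = q_binomial (real (card (UNIV :: 'a set))) m n"
  unfolding semigroup_rank_eq col_space_classes_def
  using card_col_space_classes[OF fin] nm by simp

end

theorem theorem4p14:
  fixes m n r q :: nat and J :: "'a::field mat"
  assumes "m \<ge> 1" and "n \<ge> 1"
    and "r = min m n" and "m \<noteq> n"
    and "finite (UNIV :: 'a set)" and "card (UNIV :: 'a set) = q"
    and "J = sandwich_J m n r"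
  shows "real (semigroup_rank (sandwich_mult J) (carrier_mat m n))
    = q_binomial (real q) (max m n) (min m n)"
proof (cases "n < m")
  case True
  then interpret tall_sandwich m n J
    using assms by unfold_locales auto
  show ?thesis using semigroup_rank_q_binomial True assms by simp
next
  case False
  then have mn: "m < n" using assms by simp
  \<comment> \<open>In the wide case \<open>r = m\<close>, so the transposed sandwich matrix is that
    of the tall case with \<open>m\<close> and \<open>n\<close> interchanged.\<close>
  interpret tall_sandwich n m "sandwich_J n m r :: 'a mat"
    using assms mn by unfold_locales auto
  show ?thesis
    using semigroup_rank_q_binomial semigroup_rank_sandwich_transpose[of r m n, where 'a = 'a] mn assms
    by simp
qed

end
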